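(* Let $\mathfrak g$ be a finite dimensional simple Lie algebra over $\mathbb{C}$ and $\lambda\in\mathfrak h^*$ dominant integral. Let $A_\lambda=\mathbb{C}\hat1\oplus N_\lambda$ be a vector space such that $N_\lambda\cong L_\lambda$ as $\mathfrak g$-modules, and set $B_\lambda=\mathfrak g+\partial(A_\lambda)$. Assume that $A_\lambda$ is the unital commutative associative algebra and $B_\lambda$ the vertex $A_\lambda$-algebroid with the operations described in the context; in particular $g_0g'_0a+g'_0g_0a=(g_1g')*a$ for all $a\in N_\lambda$, $g,g'\in\mathfrak g$. Then: (1) $\mathfrak g$ is of $ADE$-type; however, $\mathfrak g\neq E_8$. (2) For every $\alpha\in\Delta_+$ we have $\lambda(h_\alpha)=1$. In particular $\lambda(h_\theta)=1$. (3) Let $v_\lambda\in N_\lambda$ be such that $h\cdot v_\lambda=\lambda(h)v_\lambda$ and $g\cdot v_\lambda=0$ for all $h\in\mathfrak h$, $g\in\mathfrak g_+$. For $\alpha\in\Delta_+$ and $a\in N_\lambda$ we have $$(f_\alpha)_0(f_\alpha)_0a=0\quad\text{and}\quad(e_\alpha)_0(e_\alpha)_0a=0.$$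
   Context: Let $\langle\cdot,\cdot\rangle$ be a nondegenerate symmetric invariant bilinear form on $\mathfrak g$, $\mathfrak h$ a Cartan subalgebra identified with $\mathfrak h^*$ via the form, $\Delta$ the root system, with the form normalized so that $\langle\alpha,\alpha\rangle=2$ for long roots; $\Delta_+$ a set of positive roots, $\mathfrak g=\mathfrak g_+\oplus\mathfrak h\oplus\mathfrak g_-$ the triangular decomposition, $\theta$ the highest root. For $\alpha\in\Delta$, $h_\alpha\in\mathfrak h$ is the unique vector with $[\mathfrak g_\alpha,\mathfrak g_{-\alpha}]=\mathbb{C}h_\alpha$ and $\alpha(h_\alpha)=2$. For $\alpha\in\Delta_+$, $e_\alpha\in\mathfrak g_\alpha$ and $f_\alpha\in\mathfrak g_{-\alpha}$ are nonzero vectors with $[h_\alpha,e_\alpha]=2e_\alpha$, $[h_\alpha,f_\alpha]=-2f_\alpha$, $[e_\alpha,f_\alpha]=h_\alpha$. $L_\lambda$ is the finite dimensional irreducible $\mathfrak g$-module with highest weight $\lambda$. Operations. On $A_\lambda$: $\hat1$ is the identity, $a*a'=0$ for $a,a'\in N_\lambda$, and $\mathfrak g$ kills $\hat1$. $\partial:N_\lambda\to L_\lambda$ is a $\mathfrak g$-module isomorphism, extended to $A_\lambda$ by $\partial(\hat1)=0$. On $B_\lambda=\mathfrak g\oplus\partial(A_\lambda)$, for $u,v,g,g'\in\mathfrak g$, $m,n\in\partial(A_\lambda)$, $a,a'\in A_\lambda$: $(u+m)_0(v+n)=[u,v]+u\cdot n$; $(u+m)_0a=u\cdot a$; $a_0(u+m)=-u\cdot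 a$; $g_1g'=\langle g,g'\rangle\hat1$; $g_1\partial(a)=\partial(a)_1g=g\cdot a$; $\partial(a)_1\partial(a')=0$; $\hat1\cdot v=v$; and $a\cdot(g+\partial(a'))=\partial(g_0a)$ for $a\in N_\lambda$. A vertex $A$-algebroid is a complex vector space $B$ with a bilinear map $A\times B\to B$, $(a,v)\mapsto a\cdot v$, with $\hat1\cdot v=v$; a left Leibniz bracket $u_0v$ ($u_0(v_0w)=(u_0v)_0w+v_0(u_0w)$); a Leibniz homomorphism $B\to\mathrm{Der}(A)$, $u\mapsto(a\mapsto u_0a)$; a symmetric bilinear pairing $u_1v\in A$; a linear map $\partial:A\to B$ with $\partial(a)_0a'=0$; such that $a\cdot(a'\cdot v)-(a*a')\cdot v=(v_0a)\cdot\partial(a')+(v_0a')\cdot\partial(a)$; $u_0(a\cdot v)=(u_0a)\cdot v+a\cdot(u_0v)$; $u_0v+v_0u=\partial(u_1v)$; $(a\cdot v)_0a'=a*(v_0a')$; $(a\cdot u)_1v=a*(u_1v)-u_0v_0a$; $v_0(v^1{}_1v^2)=(v_0v^1)_1v^2+v^1{}_1(v_0v^2)$; $\partial(a*a')=a\cdot\partial(a')+a'\cdot\partial(a)$; $v_0\partial(a)=\partial(v_0a)$; $v_1\partial(a)=v_0a$. *)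

theory Defs
  imports Complex_Main "HOL-Library.Product_Plus"
begin

section \<open>Lie algebras and modules\<close>

definition bilinear_map ::
  "(complex \<Rightarrow> 'x \<Rightarrow> 'x) \<Rightarrow> (complex \<Rightarrow> 'y \<Rightarrow> 'y) \<Rightarrow> (complex \<Rightarrow> 'z \<Rightarrow> 'z)
    \<Rightarrow> ('x::ab_group_add \<Rightarrow> 'y::ab_group_add \<Rightarrow> 'z::ab_group_add) \<Rightarrow> bool"
  where "bilinear_map sx sy sz f \<longleftrightarrow>
    (\<forall>x. Vector_Spaces.linear sy sz (\<lambda>y. f x y)) \<and> (\<forall>y. Vector_Spaces.linear sx sz (\<lambda>x. f x y))"

definition finite_dim :: "(complex \<Rightarrow> 'v \<Rightarrow> 'v::ab_group_add) \<Rightarrow> bool"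
  where "finite_dim s \<longleftrightarrow> vector_space s \<and> (\<exists>S. finite S \<and> module.span s S = UNIV)"

locale lie_algebra =
  fixes sg :: "complex \<Rightarrow> 'g \<Rightarrow> 'g::ab_group_add" and br :: "'g \<Rightarrow> 'g \<Rightarrow> 'g"
  assumes br_bilinear: "bilinear_map sg sg sg br"
    and br_alternating: "br x x = 0"
    and br_jacobi: "br x (br y z) + br y (br z x) + br z (br x y) = 0"

locale simple_lie_algebra = lie_algebra sg br
  for sg :: "complex \<Rightarrow> 'g \<Rightarrow> 'g::ab_group_add" and br :: "'g \<Rightarrow> 'g \<Rightarrow> 'g" +
  assumes nonabelian: "\<exists>x y. br x y \<noteq> 0"
    and ideal_trivial: "module.subspace sg I \<Longrightarrow> (\<And>x y. y \<in> I \<Longrightarrow> br x y \<in> I) \<Longrightarrow> I = {0} \<or> I = UNIV"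

locale lie_module =
  fixes sg :: "complex \<Rightarrow> 'g \<Rightarrow> 'g::ab_group_add" and br :: "'g \<Rightarrow> 'g \<Rightarrow> 'g"
    and sv :: "complex \<Rightarrow> 'v \<Rightarrow> 'v::ab_group_add" and act :: "'g \<Rightarrow> 'v \<Rightarrow> 'v"
  assumes act_bilinear: "bilinear_map sg sv sv act"
    and act_br: "act (br x y) v = act x (act y v) - act y (act x v)"

definition irreducible_module ::
  "(complex \<Rightarrow> 'v \<Rightarrow> 'v::ab_group_add) \<Rightarrow> ('g \<Rightarrow> 'v \<Rightarrow> 'v) \<Rightarrow> bool"
  where "irreducible_module sv act \<longleftrightarrow> (\<exists>v::'v. v \<noteq> 0) \<and>
    (\<forall>W. module.subspace sv W \<longrightarrow> (\<forall>x. \<forall>w\<in>W. act x w \<in> W) \<longrightarrow> W = {0} \<or> W = UNIV)"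

definition module_iso ::
  "(complex \<Rightarrow> 'v \<Rightarrow> 'v::ab_group_add) \<Rightarrow> ('g \<Rightarrow> 'v \<Rightarrow> 'v)
    \<Rightarrow> (complex \<Rightarrow> 'w \<Rightarrow> 'w::ab_group_add) \<Rightarrow> ('g \<Rightarrow> 'w \<Rightarrow> 'w) \<Rightarrow> ('v \<Rightarrow> 'w) \<Rightarrow> bool"
  where "module_iso sv act sw act' f \<longleftrightarrow>
    Vector_Spaces.linear sv sw f \<and> bij f \<and> (\<forall>x v. f (act x v) = act' x (f v))"

section \<open>Cartan subalgebras, roots and weights\<close>

text \<open>The usual definition for complex semisimple Lie algebras: a commutative subalgebra that is
  its own centralizer and acts diagonalizably in the adjoint representation.\<close>

definition cartan_subalgebra ::
  "(complex \<Rightarrow> 'g \<Rightarrow> 'g::ab_group_add) \<Rightarrow> ('g \<Rightarrow> 'g \<Rightarrow> 'g) \<Rightarrow> 'g set \<Rightarrow> bool"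
  where "cartan_subalgebra sg br H \<longleftrightarrow> module.subspace sg H \<and>
    (\<forall>x\<in>H. \<forall>y\<in>H. br x y = 0) \<and>
    (\<forall>x. (\<forall>h\<in>H. br h x = 0) \<longrightarrow> x \<in> H) \<and>
    (\<forall>h\<in>H. module.span sg {x. \<exists>c. br h x = sg c x} = UNIV)"

text \<open>A linear functional on the subspace \<open>H\<close> is represented by the function on the whole
  type that vanishes off \<open>H\<close>, so that equal functionals are equal functions.\<close>

definition dual_space :: "(complex \<Rightarrow> 'g \<Rightarrow> 'g::ab_group_add) \<Rightarrow> 'g set \<Rightarrow> ('g \<Rightarrow> complex) set"
  where "dual_space sg H = {\<phi>. (\<forall>x\<in>H. \<forall>y\<in>H. \<phi> (x + y) = \<phi> x + \<phi> y) \<and>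
    (\<forall>c. \<forall>x\<in>H. \<phi> (sg c x) = c * \<phi> x) \<and> (\<forall>x. x \<notin> H \<longrightarrow> \<phi> x = 0)}"

definition root_space ::
  "(complex \<Rightarrow> 'g \<Rightarrow> 'g::ab_group_add) \<Rightarrow> ('g \<Rightarrow> 'g \<Rightarrow> 'g) \<Rightarrow> 'g set \<Rightarrow> ('g \<Rightarrow> complex) \<Rightarrow> 'g set"
  where "root_space sg br H \<alpha> = {x. \<forall>h\<in>H. br h x = sg (\<alpha> h) x}"

definition roots ::
  "(complex \<Rightarrow> 'g \<Rightarrow> 'g::ab_group_add) \<Rightarrow> ('g \<Rightarrow> 'g \<Rightarrow> 'g) \<Rightarrow> 'g set \<Rightarrow> ('g \<Rightarrow> complex) set"
  where "roots sg br H =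
    {\<alpha> \<in> dual_space sg H. \<alpha> \<noteq> (\<lambda>h. 0) \<and> root_space sg br H \<alpha> \<noteq> {0}}"

definition positive_system ::
  "(complex \<Rightarrow> 'g \<Rightarrow> 'g::ab_group_add) \<Rightarrow> ('g \<Rightarrow> 'g \<Rightarrow> 'g) \<Rightarrow> 'g set \<Rightarrow> ('g \<Rightarrow> complex) set \<Rightarrow> bool"
  where "positive_system sg br H P \<longleftrightarrow> P \<subseteq> roots sg br H \<and>
    (\<forall>\<alpha>\<in>roots sg br H. (\<alpha> \<in> P) \<noteq> ((\<lambda>h. - \<alpha> h) \<in> P)) \<and>
    (\<forall>\<alpha>\<in>P. \<forall>\<beta>\<in>P. (\<lambda>h. \<alpha> h + \<beta> h) \<in> roots sg br H \<longrightarrow> (\<lambda>h. \<alpha> h + \<beta> h) \<in> P)"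

definition positive_part ::
  "(complex \<Rightarrow> 'g \<Rightarrow> 'g::ab_group_add) \<Rightarrow> ('g \<Rightarrow> 'g \<Rightarrow> 'g) \<Rightarrow> 'g set \<Rightarrow> ('g \<Rightarrow> complex) set \<Rightarrow> 'g set"
  where "positive_part sg br H P = module.span sg (\<Union>\<alpha>\<in>P. root_space sg br H \<alpha>)"

definition simple_roots :: "('g \<Rightarrow> complex) set \<Rightarrow> ('g \<Rightarrow> complex) set"
  where "simple_roots P = {\<alpha> \<in> P. \<not> (\<exists>\<beta>\<in>P. \<exists>\<gamma>\<in>P. \<alpha> = (\<lambda>h. \<beta> h + \<gamma> h))}"

definition highest_root ::
  "(complex \<Rightarrow> 'g \<Rightarrow> 'g::ab_group_add) \<Rightarrow> ('g \<Rightarrow> 'g \<Rightarrow> 'g) \<Rightarrow> 'g set \<Rightarrow> ('g \<Rightarrow> complex) set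
    \<Rightarrow> ('g \<Rightarrow> complex) \<Rightarrow> bool"
  where "highest_root sg br H P \<theta> \<longleftrightarrow> \<theta> \<in> P \<and>
    (\<forall>\<beta>\<in>roots sg br H. \<exists>c :: ('g \<Rightarrow> complex) \<Rightarrow> nat.
      \<theta> = (\<lambda>h. \<beta> h + (\<Sum>\<gamma>\<in>simple_roots P. of_nat (c \<gamma>) * \<gamma> h)))"

definition coroot ::
  "(complex \<Rightarrow> 'g \<Rightarrow> 'g::ab_group_add) \<Rightarrow> ('g \<Rightarrow> 'g \<Rightarrow> 'g) \<Rightarrow> 'g set \<Rightarrow> ('g \<Rightarrow> complex) \<Rightarrow> 'g"
  where "coroot sg br H \<alpha> = (THE t. t \<in> H \<and>
    module.span sg {br x y | x y. x \<in> root_space sg br H \<alpha> \<and> y \<in> root_space sg br H (\<lambda>h. - \<alpha> h)}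
      = range (\<lambda>c. sg c t) \<and>
    \<alpha> t = 2)"

definition dominant_integral ::
  "(complex \<Rightarrow> 'g \<Rightarrow> 'g::ab_group_add) \<Rightarrow> ('g \<Rightarrow> 'g \<Rightarrow> 'g) \<Rightarrow> 'g set \<Rightarrow> ('g \<Rightarrow> complex) set
    \<Rightarrow> ('g \<Rightarrow> complex) \<Rightarrow> bool"
  where "dominant_integral sg br H P \<Lambda> \<longleftrightarrow> \<Lambda> \<in> dual_space sg H \<and>
    (\<forall>\<alpha>\<in>P. \<exists>n::nat. \<Lambda> (coroot sg br H \<alpha>) = of_nat n)"

definition highest_weight_vector ::
  "(complex \<Rightarrow> 'g \<Rightarrow> 'g::ab_group_add) \<Rightarrow> ('g \<Rightarrow> 'g \<Rightarrow> 'g) \<Rightarrow> 'g set \<Rightarrow> ('g \<Rightarrow> complex) set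
    \<Rightarrow> (complex \<Rightarrow> 'v \<Rightarrow> 'v::ab_group_add) \<Rightarrow> ('g \<Rightarrow> 'v \<Rightarrow> 'v) \<Rightarrow> ('g \<Rightarrow> complex) \<Rightarrow> 'v \<Rightarrow> bool"
  where "highest_weight_vector sg br H P sv act \<Lambda> v \<longleftrightarrow>
    (\<forall>h\<in>H. act h v = sv (\<Lambda> h) v) \<and> (\<forall>g\<in>positive_part sg br H P. act g v = 0)"

definition highest_weight_irrep ::
  "(complex \<Rightarrow> 'g \<Rightarrow> 'g::ab_group_add) \<Rightarrow> ('g \<Rightarrow> 'g \<Rightarrow> 'g) \<Rightarrow> 'g set \<Rightarrow> ('g \<Rightarrow> complex) set
    \<Rightarrow> (complex \<Rightarrow> 'v \<Rightarrow> 'v::ab_group_add) \<Rightarrow> ('g \<Rightarrow> 'v \<Rightarrow> 'v) \<Rightarrow> ('g \<Rightarrow> complex) \<Rightarrow> bool"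
  where "highest_weight_irrep sg br H P sv act \<Lambda> \<longleftrightarrow>
    finite_dim sv \<and> lie_module sg br sv act \<and> irreducible_module sv act \<and>
    (\<exists>v. v \<noteq> 0 \<and> highest_weight_vector sg br H P sv act \<Lambda> v)"

section \<open>The invariant form\<close>

definition invariant_form ::
  "(complex \<Rightarrow> 'g \<Rightarrow> 'g::ab_group_add) \<Rightarrow> ('g \<Rightarrow> 'g \<Rightarrow> 'g) \<Rightarrow> ('g \<Rightarrow> 'g \<Rightarrow> complex) \<Rightarrow> bool"
  where "invariant_form sg br form \<longleftrightarrow> bilinear_map sg sg (*) form \<and>
    (\<forall>x y. form x y = form y x) \<and> (\<forall>x y z. form (br x y) z = form x (br y z)) \<and>
    (\<forall>x. (\<forall>y. form x y = 0) \<longrightarrow> x = 0)"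

definition dual_vec :: "'g set \<Rightarrow> ('g \<Rightarrow> 'g \<Rightarrow> complex) \<Rightarrow> ('g \<Rightarrow> complex) \<Rightarrow> 'g"
  where "dual_vec H form \<phi> = (THE t. t \<in> H \<and> (\<forall>h\<in>H. form t h = \<phi> h))"

definition dual_form ::
  "'g set \<Rightarrow> ('g \<Rightarrow> 'g \<Rightarrow> complex) \<Rightarrow> ('g \<Rightarrow> complex) \<Rightarrow> ('g \<Rightarrow> complex) \<Rightarrow> complex"
  where "dual_form H form \<phi> \<psi> = form (dual_vec H form \<phi>) (dual_vec H form \<psi>)"

text \<open>Before normalization the values \<open>dual_form H form \<alpha> \<alpha>\<close> are a common complex multiple of
  positive reals; comparing moduli makes ``long'' independent of that multiple.
  In the simply laced case every root is long.\<close>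

definition long_root ::
  "(complex \<Rightarrow> 'g \<Rightarrow> 'g::ab_group_add) \<Rightarrow> ('g \<Rightarrow> 'g \<Rightarrow> 'g) \<Rightarrow> 'g set \<Rightarrow> ('g \<Rightarrow> 'g \<Rightarrow> complex)
    \<Rightarrow> ('g \<Rightarrow> complex) \<Rightarrow> bool"
  where "long_root sg br H form \<alpha> \<longleftrightarrow> \<alpha> \<in> roots sg br H \<and>
    (\<forall>\<beta>\<in>roots sg br H. cmod (dual_form H form \<beta> \<beta>) \<le> cmod (dual_form H form \<alpha> \<alpha>))"

definition normalized_form ::
  "(complex \<Rightarrow> 'g \<Rightarrow> 'g::ab_group_add) \<Rightarrow> ('g \<Rightarrow> 'g \<Rightarrow> 'g) \<Rightarrow> 'g set \<Rightarrow> ('g \<Rightarrow> 'g \<Rightarrow> complex) \<Rightarrow> bool"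
  where "normalized_form sg br H form \<longleftrightarrow>
    (\<forall>\<alpha>. long_root sg br H form \<alpha> \<longrightarrow> dual_form H form \<alpha> \<alpha> = 2)"

section \<open>Simply laced Dynkin types\<close>

text \<open>A simply laced Dynkin diagram on the nodes \<open>{..<n}\<close> is given by a relation \<open>E\<close>,
  whose symmetric closure is the adjacency relation.\<close>

definition simply_laced_cartan :: "(nat \<Rightarrow> nat \<Rightarrow> bool) \<Rightarrow> nat \<Rightarrow> nat \<Rightarrow> complex"
  where "simply_laced_cartan E i j = (if i = j then 2 else if E i j \<or> E j i then - 1 else 0)"

definition has_dynkin_diagram ::
  "(complex \<Rightarrow> 'g \<Rightarrow> 'g::ab_group_add) \<Rightarrow> ('g \<Rightarrow> 'g \<Rightarrow> 'g) \<Rightarrow> 'g set \<Rightarrow> ('g \<Rightarrow> complex) set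
    \<Rightarrow> nat \<Rightarrow> (nat \<Rightarrow> nat \<Rightarrow> bool) \<Rightarrow> bool"
  where "has_dynkin_diagram sg br H P n E \<longleftrightarrow>
    (\<exists>p. bij_betw p {..<n} (simple_roots P) \<and>
      (\<forall>i<n. \<forall>j<n. p j (coroot sg br H (p i)) = simply_laced_cartan E i j))"

text \<open>\<open>A\<^sub>n\<close> is the path on \<open>n\<close> nodes; \<open>D\<^sub>n\<close> (resp. \<open>E\<^sub>n\<close>) is the path on the first \<open>n - 1\<close>
  nodes with the last node attached to node \<open>n - 3\<close>, the last but one of the path (resp. to node 2,
  the third of the path).\<close>

definition edges_A :: "nat \<Rightarrow> nat \<Rightarrow> bool"
  where "edges_A i j \<longleftrightarrow> j = i + 1"

definition edges_D :: "nat \<Rightarrow> nat \<Rightarrow> nat \<Rightarrow> bool"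
  where "edges_D n i j \<longleftrightarrow> (j = i + 1 \<and> j < n - 1) \<or> (i = n - 3 \<and> j = n - 1)"

definition edges_E :: "nat \<Rightarrow> nat \<Rightarrow> nat \<Rightarrow> bool"
  where "edges_E n i j \<longleftrightarrow> (j = i + 1 \<and> j < n - 1) \<or> (i = 2 \<and> j = n - 1)"

definition ADE_type ::
  "(complex \<Rightarrow> 'g \<Rightarrow> 'g::ab_group_add) \<Rightarrow> ('g \<Rightarrow> 'g \<Rightarrow> 'g) \<Rightarrow> 'g set \<Rightarrow> ('g \<Rightarrow> complex) set \<Rightarrow> bool"
  where "ADE_type sg br H P \<longleftrightarrow>
    (\<exists>n\<ge>1. has_dynkin_diagram sg br H P n edges_A) \<or>
    (\<exists>n\<ge>4. has_dynkin_diagram sg br H P n (edges_D n)) \<or>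
    (\<exists>n\<in>{6,7,8}. has_dynkin_diagram sg br H P n (edges_E n))"

definition E8_type ::
  "(complex \<Rightarrow> 'g \<Rightarrow> 'g::ab_group_add) \<Rightarrow> ('g \<Rightarrow> 'g \<Rightarrow> 'g) \<Rightarrow> 'g set \<Rightarrow> ('g \<Rightarrow> complex) set \<Rightarrow> bool"
  where "E8_type sg br H P \<longleftrightarrow> has_dynkin_diagram sg br H P 8 (edges_E 8)"

section \<open>Vertex algebroids\<close>

locale unital_comm_algebra =
  fixes sA :: "complex \<Rightarrow> 'a \<Rightarrow> 'a::ab_group_add" and mul :: "'a \<Rightarrow> 'a \<Rightarrow> 'a" and one :: 'a
  assumes mul_bilinear: "bilinear_map sA sA sA mul"
    and mul_assoc: "mul (mul a b) c = mul a (mul b c)"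
    and mul_comm: "mul a b = mul b a"
    and mul_one: "mul one a = a"

text \<open>For \<open>u, v \<in> B\<close> and \<open>a \<in> A\<close>: \<open>dot a v\<close> is \<open>a \<cdot> v\<close>, \<open>zeroB u v\<close> is \<open>u\<^sub>0v\<close>, \<open>zeroA u a\<close> is
  \<open>u\<^sub>0a\<close> and \<open>pair u v\<close> is \<open>u\<^sub>1v\<close>. The algebra is written \<open>'a\<close>, the module \<open>'b\<close>.\<close>

locale vertex_algebroid = unital_comm_algebra sA mul one
  for sA :: "complex \<Rightarrow> 'a \<Rightarrow> 'a::ab_group_add" and mul :: "'a \<Rightarrow> 'a \<Rightarrow> 'a" and one :: 'a +
  fixes sB :: "complex \<Rightarrow> 'b \<Rightarrow> 'b::ab_group_add"
    and dot :: "'a \<Rightarrow> 'b \<Rightarrow> 'b"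
    and zeroB :: "'b \<Rightarrow> 'b \<Rightarrow> 'b"
    and zeroA :: "'b \<Rightarrow> 'a \<Rightarrow> 'a"
    and pair :: "'b \<Rightarrow> 'b \<Rightarrow> 'a"
    and del :: "'a \<Rightarrow> 'b"
  assumes dot_bilinear: "bilinear_map sA sB sB dot"
    and dot_one: "dot one v = v"
    and zeroB_bilinear: "bilinear_map sB sB sB zeroB"
    and zeroB_leibniz: "zeroB u (zeroB v w) = zeroB (zeroB u v) w + zeroB v (zeroB u w)"
    and zeroA_bilinear: "bilinear_map sB sA sA zeroA"
    and zeroA_derivation: "zeroA u (mul a b) = mul (zeroA u a) b + mul a (zeroA u b)"
    and zeroA_hom: "zeroA (zeroB u v) a = zeroA u (zeroA v a) - zeroA v (zeroA u a)"
    and pair_bilinear: "bilinear_map sB sB sA pair"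
    and pair_sym: "pair u v = pair v u"
    and del_linear: "Vector_Spaces.linear sA sB del"
    and del_zeroA: "zeroA (del a) b = 0"
    and dot_dot: "dot a (dot b v) - dot (mul a b) v = dot (zeroA v a) (del b) + dot (zeroA v b) (del a)"
    and zeroB_dot: "zeroB u (dot a v) = dot (zeroA u a) v + dot a (zeroB u v)"
    and zeroB_sym: "zeroB u v + zeroB v u = del (pair u v)"
    and dot_zeroA: "zeroA (dot a v) b = mul a (zeroA v b)"
    and pair_dot: "pair (dot a u) v = mul a (pair u v) - zeroA u (zeroA v a)"
    and zeroA_pair: "zeroA v (pair u w) = pair (zeroB v u) w + pair u (zeroB v w)"
    and del_mul: "del (mul a b) = dot a (del b) + dot b (del a)"
    and zeroB_del: "zeroB v (del a) = del (zeroA v a)"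
    and pair_del: "pair v (del a) = zeroA v a"

section \<open>The concrete operations\<close>

text \<open>\<open>A\<^sub>\<lambda>\<close> is the type \<open>complex \<times> 'n\<close> with \<open>'n\<close> the module \<open>N\<^sub>\<lambda>\<close>, and \<open>B\<^sub>\<lambda>\<close> is \<open>'g \<times> 'l\<close> with \<open>'l\<close> the
  module \<open>L\<^sub>\<lambda> = \<partial>(A\<^sub>\<lambda>)\<close>. The parameter \<open>d :: 'n \<Rightarrow> 'l\<close> is the isomorphism \<open>\<partial>\<close> on \<open>N\<^sub>\<lambda>\<close>.\<close>

definition scale_prod ::
  "(complex \<Rightarrow> 'x \<Rightarrow> 'x) \<Rightarrow> (complex \<Rightarrow> 'y \<Rightarrow> 'y) \<Rightarrow> complex \<Rightarrow> 'x \<times> 'y \<Rightarrow> 'x \<times> 'y"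
  where "scale_prod sx sy c p = (sx c (fst p), sy c (snd p))"

definition A_one :: "complex \<times> 'n::ab_group_add"
  where "A_one = (1, 0)"

definition A_mul :: "(complex \<Rightarrow> 'n \<Rightarrow> 'n::ab_group_add) \<Rightarrow> complex \<times> 'n \<Rightarrow> complex \<times> 'n \<Rightarrow> complex \<times> 'n"
  where "A_mul sn a b = (fst a * fst b, sn (fst a) (snd b) + sn (fst b) (snd a))"

definition AB_del :: "('n \<Rightarrow> 'l) \<Rightarrow> complex \<times> 'n \<Rightarrow> 'g::ab_group_add \<times> 'l"
  where "AB_del d a = (0, d (snd a))"

definition B_zero :: "('g \<Rightarrow> 'g \<Rightarrow> 'g) \<Rightarrow> ('g \<Rightarrow> 'l \<Rightarrow> 'l) \<Rightarrow> 'g \<times> 'l \<Rightarrow> 'g \<times> 'l \<Rightarrow> 'g \<times> 'l"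
  where "B_zero br actL u v = (br (fst u) (fst v), actL (fst u) (snd v))"

definition BA_zero :: "('g \<Rightarrow> 'n \<Rightarrow> 'n) \<Rightarrow> 'g \<times> 'l \<Rightarrow> complex \<times> 'n \<Rightarrow> complex \<times> 'n"
  where "BA_zero actN u a = (0, actN (fst u) (snd a))"

definition B_pair ::
  "('g \<Rightarrow> 'g \<Rightarrow> complex) \<Rightarrow> ('g \<Rightarrow> 'n \<Rightarrow> 'n::ab_group_add) \<Rightarrow> ('n \<Rightarrow> 'l)
    \<Rightarrow> 'g \<times> 'l \<Rightarrow> 'g \<times> 'l \<Rightarrow> complex \<times> 'n"
  where "B_pair form actN d u v =
    (form (fst u) (fst v), actN (fst u) (inv d (snd v)) + actN (fst v) (inv d (snd u)))"

definition AB_dot ::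
  "(complex \<Rightarrow> 'g \<Rightarrow> 'g) \<Rightarrow> (complex \<Rightarrow> 'l \<Rightarrow> 'l::ab_group_add) \<Rightarrow> ('g \<Rightarrow> 'n \<Rightarrow> 'n) \<Rightarrow> ('n \<Rightarrow> 'l)
    \<Rightarrow> complex \<times> 'n \<Rightarrow> 'g \<times> 'l \<Rightarrow> 'g \<times> 'l"
  where "AB_dot sg sl actN d a v =
    (sg (fst a) (fst v), sl (fst a) (snd v) + d (actN (fst v) (snd a)))"

end

theory Submission
  imports Defs
begin

text \<open>The axiom for \<open>(a \<cdot> u)\<^sub>1v\<close>, applied to \<open>a \<in> N\<^sub>\<lambda>\<close> and \<open>u, v \<in> \<gg>\<close>, is the Clifford relation
  \<open>x y a + y x a = \<langle>x, y\<rangle> a\<close>. On a weight vector it gives \<open>2 \<lambda>(h) \<lambda>(h') = \<langle>h, h'\<rangle>\<close> for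
  \<open>h, h'\<close> in the Cartan subalgebra. Hence \<open>h\<close> with \<open>\<lambda>(h) = 0\<close> squares to zero on \<open>N\<^sub>\<lambda>\<close>, and the
  relation then forces \<open>\<langle>h, x\<rangle> = 0\<close> for every eigenvector \<open>x\<close> of \<open>ad h\<close>, so \<open>h = 0\<close>. The Cartan
  subalgebra is therefore a line, the only roots are \<open>\<plusminus>2\<lambda>\<close>, and \<open>\<gg>\<close> is of type \<open>A\<^sub>1\<close>.
  Root vectors are isotropic, so they square to zero on \<open>N\<^sub>\<lambda>\<close>.\<close>

locale clifford_lie_module =
  G: vector_space sg + N: vector_space sn + lie_algebra sg br + lie_module sg br sn act
  for sg :: "complex \<Rightarrow> 'g \<Rightarrow> 'g::ab_group_add" and br :: "'g \<Rightarrow> 'g \<Rightarrow> 'g"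
    and sn :: "complex \<Rightarrow> 'n \<Rightarrow> 'n::ab_group_add" and act :: "'g \<Rightarrow> 'n \<Rightarrow> 'n" +
  fixes form :: "'g \<Rightarrow> 'g \<Rightarrow> complex" and H :: "'g set" and \<Lambda> :: "'g \<Rightarrow> complex" and w :: 'n
  assumes nonabelian: "\<exists>x y. br x y \<noteq> 0"
    and form: "invariant_form sg br form"
    and cartan: "cartan_subalgebra sg br H"
    and clifford: "act x (act y a) + act y (act x a) = sn (form x y) a"
    and weight_dual: "\<Lambda> \<in> dual_space sg H"
    and weight_vector: "h \<in> H \<Longrightarrow> act h w = sn (\<Lambda> h) w"
    and weight_vector_nonzero: "w \<noteq> 0"
begin

section \<open>Linearity rules and unfolded hypotheses\<close>

lemma act_scale: "act x (sn c a) = sn c (act x a)" "act (sg c x) a = sn c (act x a)"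
  using act_bilinear by (auto simp: bilinear_map_def Vector_Spaces.linear_iff)

lemma br_add: "br x (y + z) = br x y + br x z" "br (x + y) z = br x z + br y z"
  and br_scale: "br x (sg c y) = sg c (br x y)" "br (sg c x) y = sg c (br x y)"
  using br_bilinear by (auto simp: bilinear_map_def Vector_Spaces.linear_iff)

lemma form_add: "form x (y + z) = form x y + form x z" "form (x + y) z = form x z + form y z"
  and form_scale: "form x (sg c y) = c * form x y" "form (sg c x) y = c * form x y"
  using form by (auto simp: invariant_form_def bilinear_map_def Vector_Spaces.linear_iff)

lemma form_invariant: "form (br x y) z = form x (br y z)"
  and form_nondegenerate: "(\<And>y. form x y = 0) \<Longrightarrow> x = 0"
  using form by (auto simp: invariant_form_def)

lemma act_zero [simp]: "act x 0 = 0" "act 0 a = 0"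
  using act_scale(1)[of x 0 0] act_scale(2)[of 0 0 a] by auto

lemma br_zero [simp]: "br x 0 = 0" "br 0 y = 0"
  using br_scale(1)[of x 0 0] br_scale(2)[of 0 0 y] by auto

lemma form_zero [simp]: "form x 0 = 0" "form 0 y = 0"
  using form_scale(1)[of x 0 0] form_scale(2)[of 0 0 y] by auto

lemma br_anticomm: "br x y = - br y x"
  using br_alternating[of "x + y"] br_alternating[of x] br_alternating[of y]
  by (simp add: br_add eq_neg_iff_add_eq_0 add.commute)

lemma br_uminus: "br x (- y) = - br x y"
  using br_add(1)[of x y "- y"] by (simp add: eq_neg_iff_add_eq_0 add.commute)

lemma H_subspace: "G.subspace H"
  and H_commute: "\<lbrakk>x \<in> H; y \<in> H\<rbrakk> \<Longrightarrow> br x y = 0"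
  and H_self_centralizing: "(\<And>h. h \<in> H \<Longrightarrow> br h x = 0) \<Longrightarrow> x \<in> H"
  and H_diagonalizable: "h \<in> H \<Longrightarrow> G.span {x. \<exists>c. br h x = sg c x} = UNIV"
  using cartan by (auto simp: cartan_subalgebra_def)

lemma weight_scale: "h \<in> H \<Longrightarrow> \<Lambda> (sg c h) = c * \<Lambda> h"
  and weight_add: "\<lbrakk>h \<in> H; k \<in> H\<rbrakk> \<Longrightarrow> \<Lambda> (h + k) = \<Lambda> h + \<Lambda> k"
  and weight_off_H: "h \<notin> H \<Longrightarrow> \<Lambda> h = 0"
  using weight_dual by (auto simp: dual_space_def)

section \<open>Operator identities and orthogonality of eigenvectors\<close>

text \<open>The Clifford relation is the anticommutator and \<open>act_br\<close> the commutator;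
  their sum expresses a product of two operators as a scalar plus the action of a bracket.\<close>

lemma act_act: "sn 2 (act x (act y a)) = sn (form x y) a + act (br x y) a"
proof -
  have "sn 2 (act x (act y a)) = act x (act y a) + act x (act y a)"
    using N.scale_left_distrib[of 1 1] by simp
  moreover have "sn (form x y) a = act x (act y a) + (act x (act y a) - act (br x y) a)"
    using clifford[of x y a] by (simp add: act_br)
  ultimately show ?thesis
    by (simp add: algebra_simps)
qed

lemma act_isotropic: "form x x = 0 \<Longrightarrow> act x (act x a) = 0"
  using act_act[of x x a] by (simp add: br_alternating)

text \<open>Evaluating the Clifford relation at the nonzero vector \<open>w\<close> recovers
  \<open>form x y\<close>, so an element acting by zero lies in the radical of the form.\<close>

lemma act_faithful:
  assumes "\<And>a. act x a = 0"
  shows "x = 0"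
proof (rule form_nondegenerate)
  fix y
  have "sn (form x y) w = 0"
    using clifford[of x y w] assms by simp
  then show "form x y = 0"
    using weight_vector_nonzero by simp
qed

text \<open>On \<open>w\<close> both sides of \<open>act_act\<close> are scalars and the bracket
  vanishes. Thus the form restricted to \<open>H\<close> is a multiple of the square of a single
  functional.\<close>

lemma form_Cartan:
  assumes "h \<in> H" "k \<in> H"
  shows "form h k = 2 * \<Lambda> h * \<Lambda> k"
proof -
  have "sn (form h k) w = sn (2 * \<Lambda> h * \<Lambda> k) w"
    using act_act[of h k w] assms
    by (auto simp: weight_vector act_scale H_commute mult_ac)
  then show ?thesis
    using weight_vector_nonzero by auto
qed

text \<open>By invariance \<open>ad h\<close> is skew for the form: moving it from one argument to
  the other changes the eigenvalue \<open>c\<close> into \<open>- b\<close>.\<close>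

lemma form_eigenvectors:
  assumes "br h x = sg b x" "br h y = sg c y" "form x y \<noteq> 0"
  shows "b + c = 0"
proof -
  have "br x h = sg (- b) x"
    using assms(1) br_anticomm[of x h] by simp
  then have "form (br x h) y = - b * form x y"
    by (simp only: form_scale)
  moreover have "form (br x h) y = c * form x y"
    using assms(2) by (simp add: form_invariant form_scale)
  ultimately have "(b + c) * form x y = 0"
    by (simp add: distrib_right)
  then show ?thesis
    using assms(3) by simp
qed

text \<open>The vectors orthogonal to \<open>x\<close> form a subspace. If it contained all
  eigenvectors of \<open>ad h\<close>, which span, nondegeneracy would give
  \<open>x = 0\<close>.\<close>

lemma eigenvector_pairing:
  assumes h: "h \<in> H" and x: "x \<noteq> 0"
  obtains y c where "br h y = sg c y" "form x y \<noteq> 0"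
proof -
  have False if "\<And>y c. br h y = sg c y \<Longrightarrow> form x y = 0"
  proof -
    have "G.subspace {y. form x y = 0}"
      by (auto simp: G.subspace_def form_add form_scale)
    then have "G.span {y. \<exists>c. br h y = sg c y} \<subseteq> {y. form x y = 0}"
      using that by (intro G.span_minimal) auto
    then show False
      using H_diagonalizable[OF h] form_nondegenerate[of x] x by auto
  qed
  then show ?thesis
    using that by blast
qed

section \<open>The Cartan subalgebra is a line\<close>

lemma weight_injective:
  assumes h: "h \<in> H" and "\<Lambda> h = 0"
  shows "h = 0"
proof (rule ccontr)
  assume "h \<noteq> 0"
  then obtain x c where x: "br h x = sg c x" "form h x \<noteq> 0"
    using eigenvector_pairing[OF h] by metis
  \<comment> \<open>\<open>h\<close> is itself an eigenvector for the eigenvalue 0, so the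
    \<open>x\<close> pairing with it must commute with it.\<close>
  have "br h h = sg 0 h"
    by (simp add: br_alternating)
  then have "c = 0"
    using form_eigenvectors[OF _ x(1,2), of 0] by simp
  have "act h (act h a) = 0" for a
    using assms by (intro act_isotropic) (simp add: form_Cartan)
  moreover have "sn 2 (act h (act x a)) = sn (form h x) a" for a
    using act_act[of h x a] x(1) \<open>c = 0\<close> by simp
  \<comment> \<open>Applying \<open>act h\<close> to the second identity makes its left side vanish
    by the first.\<close>
  ultimately have "sn (form h x) (act h a) = 0" for a
    by (metis act_scale(1) N.scale_zero_right)
  then have "act h a = 0" for a
    using x(2) by simp
  then show False
    using act_faithful \<open>h \<noteq> 0\<close> by blast
qed

lemma coweight_exists:
  obtains t where "t \<in> H" "\<Lambda> t = 1"
proof -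
  \<comment> \<open>If \<open>H\<close> were zero, every element would centralize it, hence lie in
    it, and the algebra would be zero.\<close>
  obtain h where h: "h \<in> H" "h \<noteq> 0"
    using H_self_centralizing nonabelian br_zero by metis
  then have "\<Lambda> h \<noteq> 0"
    using weight_injective by blast
  with h have "sg (1 / \<Lambda> h) h \<in> H" "\<Lambda> (sg (1 / \<Lambda> h) h) = 1"
    using H_subspace by (auto simp: G.subspace_def weight_scale)
  then show ?thesis
    using that by blast
qed

lemma Cartan_line:
  assumes "t \<in> H" "\<Lambda> t = 1" "h \<in> H"
  shows "h = sg (\<Lambda> h) t"
proof -
  have t: "sg (- \<Lambda> h) t \<in> H"
    using H_subspace assms(1) by (rule G.subspace_scale)
  have "\<Lambda> (h + sg (- \<Lambda> h) t) = 0"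
    unfolding weight_add[OF assms(3) t] weight_scale[OF assms(1)] using assms(2) by simp
  then have "h + sg (- \<Lambda> h) t = 0"
    using H_subspace assms(3) t by (intro weight_injective G.subspace_add)
  then show ?thesis
    by simp
qed

section \<open>Roots and positive systems\<close>

text \<open>Since \<open>c\<close> is nonzero, \<open>x\<close> is orthogonal to \<open>t\<close>,
  so \<open>2 t x = c x\<close> as operators and \<open>4 t t x = c c x\<close>. But
  \<open>2 t t\<close> is the scalar \<open>form t t\<close>, which equals
  \<open>2 * (\<Lambda> t)\<^sup>2\<close>; as \<open>x\<close> acts nontrivially, the scalars
  agree.\<close>

lemma ad_eigenvalue:
  assumes t: "t \<in> H" and x: "x \<noteq> 0" "br t x = sg c x" and "c \<noteq> 0"
  shows "c\<^sup>2 = (2 * \<Lambda> t)\<^sup>2"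
proof -
  have "br t t = sg 0 t"
    by (simp add: br_alternating)
  then have "form t x = 0"
    using form_eigenvectors[OF _ x(2)] \<open>c \<noteq> 0\<close> by fastforce
  then have *: "sn 2 (act t (act x a)) = sn c (act x a)" for a
    using act_act[of t x a] x(2) by (simp add: act_scale)
  have "sn (c * c) (act x a) = sn ((2 * \<Lambda> t)\<^sup>2) (act x a)" for a
  proof -
    have "sn (c * c) (act x a) = sn 2 (act t (sn c (act x a)))"
      using *[of a] by (simp add: act_scale N.scale_left_commute[of 2 c] flip: N.scale_scale)
    also have "\<dots> = sn 2 (sn 2 (act t (act t (act x a))))"
      using *[of a] by (metis act_scale(1))
    also have "\<dots> = sn 2 (sn (form t t) (act x a))"
      using act_act[of t t "act x a"] by (simp add: br_alternating)
    finally show ?thesis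
      using t by (simp add: form_Cartan power2_eq_square mult_ac)
  qed
  moreover obtain a where "act x a \<noteq> 0"
    using act_faithful x(1) by blast
  ultimately show ?thesis
    by (metis N.scale_cancel_right power2_eq_square)
qed

lemma root_dual: "\<beta> \<in> roots sg br H \<Longrightarrow> \<beta> \<in> dual_space sg H"
  by (simp add: roots_def)

lemma root_vector:
  assumes "\<beta> \<in> roots sg br H"
  obtains x where "x \<noteq> 0" "x \<in> root_space sg br H \<beta>"
proof -
  have "0 \<in> root_space sg br H \<beta>"
    by (simp add: root_space_def)
  then show ?thesis
    using assms that unfolding roots_def by blast
qed

text \<open>On a line every functional is a multiple of \<open>\<Lambda>\<close>;
  \<open>ad_eigenvalue\<close> determines the factor up to sign.\<close>

lemma roots_eq_weight:
  assumes \<beta>: "\<beta> \<in> roots sg br H"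
  shows "\<beta> = (\<lambda>h. 2 * \<Lambda> h) \<or> \<beta> = (\<lambda>h. - (2 * \<Lambda> h))"
proof -
  obtain t where t: "t \<in> H" "\<Lambda> t = 1"
    by (rule coweight_exists)
  have \<beta>t: "\<beta> h = \<beta> t * \<Lambda> h" for h
  proof (cases "h \<in> H")
    case True
    have "\<beta> h = \<beta> (sg (\<Lambda> h) t)"
      using Cartan_line[OF t True] by (rule arg_cong)
    then show ?thesis
      using root_dual[OF \<beta>] t(1) by (simp add: dual_space_def)
  next
    \<comment> \<open>Off \<open>H\<close> both functions are zero by the encoding of functionals,
      so the equality holds on the whole type.\<close>
    case False
    then show ?thesis
      using root_dual[OF \<beta>] by (simp add: dual_space_def weight_off_H)
  qed
  obtain x where x: "x \<noteq> 0" "x \<in> root_space sg br H \<beta>"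
    using \<beta> by (rule root_vector)
  have "\<beta> t \<noteq> 0"
  proof
    assume "\<beta> t = 0"
    then have "\<beta> h = 0" for h
      using \<beta>t[of h] by simp
    then show False
      using \<beta> by (auto simp: roots_def)
  qed
  then have "(\<beta> t)\<^sup>2 = (2 * \<Lambda> t)\<^sup>2"
    using t x by (intro ad_eigenvalue[of t x]) (auto simp: root_space_def)
  then have "\<beta> t = 2 \<or> \<beta> t = - 2"
    unfolding power2_eq_iff t(2) by simp
  moreover have "\<beta> = (\<lambda>h. \<beta> t * \<Lambda> h)"
    using \<beta>t by (rule ext)
  ultimately show ?thesis
    by (metis mult_minus_left)
qed

text \<open>Two distinct roots are opposite to each other, and a positive system never contains
  both.\<close>

lemma positive_system_singleton:
  assumes P: "positive_system sg br H P" and \<theta>: "\<theta> \<in> P"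
  shows "P = {\<theta>}"
proof -
  have "\<beta> = \<theta>" if "\<beta> \<in> P" for \<beta>
  proof (rule ccontr)
    assume "\<beta> \<noteq> \<theta>"
    moreover have "\<beta> \<in> roots sg br H" "\<theta> \<in> roots sg br H"
      using P \<theta> that by (auto simp: positive_system_def)
    then have "\<beta> = (\<lambda>h. 2 * \<Lambda> h) \<or> \<beta> = (\<lambda>h. - (2 * \<Lambda> h))"
      and "\<theta> = (\<lambda>h. 2 * \<Lambda> h) \<or> \<theta> = (\<lambda>h. - (2 * \<Lambda> h))"
      by (simp_all only: roots_eq_weight)
    ultimately have "\<beta> = (\<lambda>h. - \<theta> h)"
      by (elim disjE) simp_all
    then show False
      using P \<theta> that by (auto simp: positive_system_def)
  qed
  then show ?thesis
    using \<theta> by blast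
qed

section \<open>Coroots\<close>

text \<open>For a root \<open>2 * r * \<Lambda>\<close> with \<open>r\<close> a sign, multiplying
  the coweight by \<open>r\<close> makes the root take the value 2. The sign of
  \<open>\<Lambda> t\<close> is that of \<open>r\<close>, hence only its square is fixed
  here.\<close>

lemma root_coweight:
  assumes \<beta>: "\<beta> \<in> roots sg br H"
  obtains t where "t \<in> H" "\<beta> t = 2" "(\<Lambda> t)\<^sup>2 = 1" "H = range (\<lambda>c. sg c t)"
proof -
  obtain s where s: "s \<in> H" "\<Lambda> s = 1"
    by (rule coweight_exists)
  obtain r :: complex where r: "r = 1 \<or> r = - 1" "\<beta> = (\<lambda>h. 2 * r * \<Lambda> h)"
    using roots_eq_weight[OF \<beta>] by fastforce
  let ?t = "sg r s"
  have H: "sg c h \<in> H" if "h \<in> H" for c h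
    using H_subspace that by (auto simp: G.subspace_def)
  have "h \<in> range (\<lambda>c. sg c ?t)" if "h \<in> H" for h
  proof
    show "h = sg (r * \<Lambda> h) ?t"
      using Cartan_line[OF s that] r(1) by auto
  qed simp
  moreover have "range (\<lambda>c. sg c ?t) \<subseteq> H"
    using H s(1) by auto
  ultimately have "H = range (\<lambda>c. sg c ?t)"
    by blast
  moreover have "?t \<in> H" "\<beta> ?t = 2" "(\<Lambda> ?t)\<^sup>2 = 1"
    using H s r by (auto simp: weight_scale)
  ultimately show ?thesis
    using that by blast
qed

text \<open>By the Jacobi identity the bracket has weight zero, so it centralizes
  \<open>H\<close>.\<close>

lemma br_opposite_root_spaces:
  assumes "x \<in> root_space sg br H \<beta>" "y \<in> root_space sg br H (\<lambda>h. - \<beta> h)"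
  shows "br x y \<in> H"
proof (rule H_self_centralizing)
  fix h assume h: "h \<in> H"
  then have "br h x = sg (\<beta> h) x" "br h y = sg (- \<beta> h) y"
    using assms by (auto simp: root_space_def)
  then show "br h (br x y) = 0"
    using br_jacobi[of h x y] br_anticomm[of y h] br_anticomm[of y x]
    by (simp add: br_scale br_uminus)
qed

text \<open>This evaluates the span in the definition of \<open>coroot\<close>. As \<open>H\<close>
  is a line, one nonzero bracket suffices, and \<open>form t (br x y) = 2 * form x y\<close>
  provides it.\<close>

lemma span_br_root_spaces:
  assumes \<beta>: "\<beta> \<in> roots sg br H"
  shows "G.span {br x y | x y. x \<in> root_space sg br H \<beta> \<and> y \<in> root_space sg br H (\<lambda>h. - \<beta> h)} = H"
    (is "G.span ?S = H")
proof
  show "G.span ?S \<subseteq> H"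
    using br_opposite_root_spaces H_subspace by (intro G.span_minimal) auto
next
  obtain t where t: "t \<in> H" "\<beta> t = 2" "H = range (\<lambda>c. sg c t)"
    using root_coweight[OF \<beta>] by metis
  obtain x where x: "x \<noteq> 0" "x \<in> root_space sg br H \<beta>"
    using \<beta> by (rule root_vector)
  then have tx: "br t x = sg 2 x"
    using t(1,2) by (simp add: root_space_def)
  obtain y c where y: "br t y = sg c y" "form x y \<noteq> 0"
    using eigenvector_pairing[OF t(1) x(1)] by blast
  \<comment> \<open>The partner \<open>y\<close> was chosen only as an eigenvector pairing with
    \<open>x\<close>; orthogonality forces its eigenvalue, and as \<open>t\<close> spans
    \<open>H\<close> it lies in the opposite root space.\<close>
  have c: "c = - 2"
    using form_eigenvectors[OF tx y] by (simp add: add_eq_0_iff)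
  have "\<beta> (sg b t) = b * \<beta> t" for b
    using root_dual[OF \<beta>] t(1) by (simp add: dual_space_def)
  then have "y \<in> root_space sg br H (\<lambda>h. - \<beta> h)"
    using t(2,3) y(1) c by (auto simp: root_space_def br_scale)
  with x(2) have xy: "br x y \<in> ?S"
    by blast
  then obtain b where b: "br x y = sg b t"
    using br_opposite_root_spaces[OF x(2)] t(3) \<open>y \<in> _\<close> by auto
  have "form t (br x y) = 2 * form x y"
    using form_invariant[of t x y] tx by (simp add: form_scale)
  then have "b \<noteq> 0"
    using y(2) b by auto
  then have "sg a t = sg (a / b) (br x y)" for a
    using b by simp
  moreover have "sg (a / b) (br x y) \<in> G.span ?S" for a
    using xy by (intro G.span_scale G.span_base)
  ultimately show "H \<subseteq> G.span ?S"
    unfolding t(3) by auto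
qed

lemma coroot_eq:
  assumes \<beta>: "\<beta> \<in> roots sg br H" and t: "t \<in> H" "\<beta> t = 2"
  shows "coroot sg br H \<beta> = t"
proof -
  obtain s where s: "H = range (\<lambda>c. sg c s)" "\<beta> s = 2" "s \<in> H"
    using root_coweight[OF \<beta>] by metis
  have unique: "u = s" if u: "u \<in> H" "\<beta> u = 2" for u
  proof -
    obtain c where c: "u = sg c s"
      using s(1) u(1) by auto
    then have "\<beta> u = c * \<beta> s"
      using root_dual[OF \<beta>] s(3) by (simp add: dual_space_def)
    then show ?thesis
      using u(2) s(2) c by simp
  qed
  show ?thesis
    unfolding coroot_def span_br_root_spaces[OF \<beta>]
  proof (rule the_equality)
    show "t \<in> H \<and> H = range (\<lambda>c. sg c t) \<and> \<beta> t = 2"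
      using t unique s(1) by metis
  qed (use unique t in blast)
qed

lemma weight_coroot:
  assumes "\<beta> \<in> roots sg br H"
  shows "\<beta> (coroot sg br H \<beta>) = 2" "(\<Lambda> (coroot sg br H \<beta>))\<^sup>2 = 1"
proof -
  obtain t where t: "t \<in> H" "\<beta> t = 2" "(\<Lambda> t)\<^sup>2 = 1"
    using root_coweight[OF assms] by metis
  then show "\<beta> (coroot sg br H \<beta>) = 2" "(\<Lambda> (coroot sg br H \<beta>))\<^sup>2 = 1"
    using coroot_eq[OF assms t(1,2)] by auto
qed

section \<open>Square-zero operators and the Dynkin type\<close>

text \<open>Such an \<open>x\<close> is isotropic: pairing nontrivially with itself would force
  \<open>c + c = 0\<close>.\<close>

lemma act_eigenvector_square:
  assumes "br h x = sg c x" "c \<noteq> 0"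
  shows "act x (act x a) = 0"
  using form_eigenvectors[OF assms(1,1)] assms(2) by (intro act_isotropic) auto

text \<open>The only conceivable decomposition is the root as twice itself, which fails at the
  coroot.\<close>

lemma simple_roots_singleton:
  assumes "\<theta> \<in> roots sg br H"
  shows "simple_roots {\<theta>} = {\<theta>}"
proof -
  have "\<theta> \<noteq> (\<lambda>h. \<theta> h + \<theta> h)"
  proof
    assume "\<theta> = (\<lambda>h. \<theta> h + \<theta> h)"
    then have "\<theta> (coroot sg br H \<theta>) = \<theta> (coroot sg br H \<theta>) + \<theta> (coroot sg br H \<theta>)"
      by (rule fun_cong)
    then show False
      using weight_coroot(1)[OF assms] by simp
  qed
  then show ?thesis
    by (auto simp: simple_roots_def)
qed

lemma rank_one_type:
  assumes "\<theta> \<in> roots sg br H"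
  shows "ADE_type sg br H {\<theta>}" "\<not> E8_type sg br H {\<theta>}"
proof -
  have "has_dynkin_diagram sg br H {\<theta>} 1 edges_A"
    using weight_coroot(1)[OF assms]
    by (auto simp: has_dynkin_diagram_def simple_roots_singleton[OF assms]
        simply_laced_cartan_def lessThan_Suc bij_betw_def intro!: exI[of _ "\<lambda>_. \<theta>"])
  then show "ADE_type sg br H {\<theta>}"
    by (auto simp: ADE_type_def)
  \<comment> \<open>The diagram of type \<open>E8\<close> has eight nodes, but there is only one
    simple root.\<close>
  have "card {..<8::nat} \<noteq> card {\<theta>}"
    by simp
  then have "\<not> bij_betw p {..<8} {\<theta>}" for p :: "nat \<Rightarrow> 'g \<Rightarrow> complex"
    using bij_betw_same_card by blast
  then show "\<not> E8_type sg br H {\<theta>}"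
    by (simp add: E8_type_def has_dynkin_diagram_def simple_roots_singleton[OF assms])
qed

end

section \<open>From the vertex algebroid to the three claims\<close>

lemma vertex_algebroid_clifford:
  fixes sg :: "complex \<Rightarrow> 'g \<Rightarrow> 'g::ab_group_add" and sl :: "complex \<Rightarrow> 'l \<Rightarrow> 'l::ab_group_add"
    and actN :: "'g \<Rightarrow> 'n \<Rightarrow> 'n::ab_group_add"
  assumes VA: "vertex_algebroid (scale_prod (*) sn) (A_mul sn) A_one (scale_prod sg sl)
      (AB_dot sg sl actN d) (B_zero br actL) (BA_zero actN) (B_pair form actN d) (AB_del d)"
    and N: "lie_module sg br sn actN" and d: "module_iso sn actN sl actL d"
  shows "actN x (actN y a) + actN y (actN x a) = sn (form x y) a"
proof -
  have bil: "Vector_Spaces.linear sn sn (actN z)" "Vector_Spaces.linear sg sn (\<lambda>z. actN z b)" for z b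
    using N by (auto simp: lie_module_def bilinear_map_def)
  have vs: "vector_space sg" "vector_space sn"
    using bil(2) by (auto simp: Vector_Spaces.linear_iff)
  interpret G: vector_space sg by (fact vs)
  interpret N: vector_space sn by (fact vs)
  have "Vector_Spaces.linear sn sl d"
    using d by (simp add: module_iso_def)
  then interpret D: Vector_Spaces.linear sn sl d .
  have act0: "actN z 0 = 0" "actN 0 b = 0" for z b
    using bil[THEN module_hom.zero[OF linear_iff_module_hom[THEN iffD1]]] by auto
  have inv_d: "inv d (d b) = b" for b
    using d by (simp add: module_iso_def bij_is_inj)
  have inv_d0: "inv d 0 = 0"
    using inv_d[of 0] by (simp add: D.zero)
  \<comment> \<open>In the second component the left side is \<open>y x a\<close>, because
    \<open>inv d\<close> undoes the \<open>d\<close> in \<open>AB_dot\<close>; the right side is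
    \<open>form x y\<close> times \<open>a\<close>, minus \<open>x y a\<close>.\<close>
  have "B_pair form actN d (AB_dot sg sl actN d (0, a) (x, 0)) (y, 0) =
      A_mul sn (0, a) (B_pair form actN d (x, 0) (y, 0)) - BA_zero actN (x, 0 :: 'l) (BA_zero actN (y, 0 :: 'l) (0, a))"
    by (rule vertex_algebroid.pair_dot[OF VA])
  then show ?thesis
    by (simp add: B_pair_def AB_dot_def A_mul_def BA_zero_def inv_d inv_d0 act0
        algebra_simps zero_prod_def minus_prod_def)
qed

theorem lemma13:
  fixes sg :: "complex \<Rightarrow> 'g \<Rightarrow> 'g::ab_group_add" and br :: "'g \<Rightarrow> 'g \<Rightarrow> 'g"
    and form :: "'g \<Rightarrow> 'g \<Rightarrow> complex"
    and H :: "'g set" and P :: "('g \<Rightarrow> complex) set" and \<theta> \<Lambda> :: "'g \<Rightarrow> complex"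
    and e f :: "('g \<Rightarrow> complex) \<Rightarrow> 'g"
    and sn :: "complex \<Rightarrow> 'n \<Rightarrow> 'n::ab_group_add" and actN :: "'g \<Rightarrow> 'n \<Rightarrow> 'n"
    and sl :: "complex \<Rightarrow> 'l \<Rightarrow> 'l::ab_group_add" and actL :: "'g \<Rightarrow> 'l \<Rightarrow> 'l"
    and d :: "'n \<Rightarrow> 'l"
  assumes "simple_lie_algebra sg br" and "finite_dim sg"
    and "cartan_subalgebra sg br H"
    and "invariant_form sg br form" and "normalized_form sg br H form"
    and "positive_system sg br H P"
    and "highest_root sg br H P \<theta>"
    and "\<And>\<alpha>. \<alpha> \<in> P \<Longrightarrow>
      e \<alpha> \<in> root_space sg br H \<alpha> \<and> e \<alpha> \<noteq> 0 \<and>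
      f \<alpha> \<in> root_space sg br H (\<lambda>h. - \<alpha> h) \<and> f \<alpha> \<noteq> 0 \<and>
      br (coroot sg br H \<alpha>) (e \<alpha>) = sg 2 (e \<alpha>) \<and>
      br (coroot sg br H \<alpha>) (f \<alpha>) = sg (- 2) (f \<alpha>) \<and>
      br (e \<alpha>) (f \<alpha>) = coroot sg br H \<alpha>"
    and "dominant_integral sg br H P \<Lambda>"
    and "highest_weight_irrep sg br H P sl actL \<Lambda>"
    and "lie_module sg br sn actN"
    and "module_iso sn actN sl actL d"
    and "vertex_algebroid (scale_prod (*) sn) (A_mul sn) A_one (scale_prod sg sl)
      (AB_dot sg sl actN d) (B_zero br actL) (BA_zero actN) (B_pair form actN d) (AB_del d)"
  shows "(ADE_type sg br H P \<and> \<not> E8_type sg br H P) \<and>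
    ((\<forall>\<alpha>\<in>P. \<Lambda> (coroot sg br H \<alpha>) = 1) \<and> \<Lambda> (coroot sg br H \<theta>) = 1) \<and>
    (\<forall>v. highest_weight_vector sg br H P sn actN \<Lambda> v \<longrightarrow>
      (\<forall>\<alpha>\<in>P. \<forall>a :: 'n.
        BA_zero actN (f \<alpha>, 0 :: 'l) (BA_zero actN (f \<alpha>, 0 :: 'l) (0, a)) = 0 \<and>
        BA_zero actN (e \<alpha>, 0 :: 'l) (BA_zero actN (e \<alpha>, 0 :: 'l) (0, a)) = 0))"
proof -
  note L = assms(10) and N = assms(11) and iso = assms(12)
  have d: "Vector_Spaces.linear sn sl d" "bij d" "\<And>x a. d (actN x a) = actL x (d a)"
    using iso by (auto simp: module_iso_def)
  interpret D: Vector_Spaces.linear sn sl d by (rule d(1))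
  obtain v where v: "v \<noteq> 0" "highest_weight_vector sg br H P sl actL \<Lambda> v"
    using L by (auto simp: highest_weight_irrep_def)
  \<comment> \<open>The highest weight vector is given in \<open>L\<close>; its preimage under the
    isomorphism \<open>d\<close> serves as the weight vector in \<open>N\<close>.\<close>
  obtain w where w: "d w = v"
    using d(2) by (metis bij_pointE)
  have "actN h w = sn (\<Lambda> h) w" if "h \<in> H" for h
  proof -
    have "d (actN h w) = d (sn (\<Lambda> h) w)"
      using v(2) that w by (simp add: d(3) D.scale highest_weight_vector_def)
    then show ?thesis
      using d(2) by (meson bij_is_inj injD)
  qed
  moreover have "w \<noteq> 0"
    using v(1) w D.zero by auto
  moreover have "vector_space sg" "vector_space sn" "lie_algebra sg br" "\<exists>x y. br x y \<noteq> 0"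
    using assms(1,2) d(1)
    by (auto simp: finite_dim_def Vector_Spaces.linear_iff simple_lie_algebra_def simple_lie_algebra_axioms_def)
  moreover have "\<Lambda> \<in> dual_space sg H"
    using assms(9) by (simp add: dominant_integral_def)
  ultimately interpret clifford_lie_module sg br sn actN form H \<Lambda> w
    using assms(3,4) N vertex_algebroid_clifford[OF assms(13) N iso]
    by (intro clifford_lie_module.intro clifford_lie_module_axioms.intro)
  have \<theta>: "\<theta> \<in> P" "\<theta> \<in> roots sg br H"
    using assms(6,7) by (auto simp: highest_root_def positive_system_def)
  have P: "P = {\<theta>}"
    using positive_system_singleton[OF assms(6) \<theta>(1)] .
  \<comment> \<open>Dominance removes the sign ambiguity: a natural number with square 1 is
    1.\<close>
  obtain n :: nat where n: "\<Lambda> (coroot sg br H \<theta>) = of_nat n"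
    using assms(9) \<theta>(1) by (auto simp: dominant_integral_def)
  then have "(of_nat (n\<^sup>2) :: complex) = of_nat 1"
    using weight_coroot(2)[OF \<theta>(2)] by simp
  then have "n\<^sup>2 = 1"
    by (simp only: of_nat_eq_iff)
  then have \<Lambda>: "\<Lambda> (coroot sg br H \<theta>) = 1"
    using n by simp
  have ef: "br (coroot sg br H \<theta>) (e \<theta>) = sg 2 (e \<theta>)" "br (coroot sg br H \<theta>) (f \<theta>) = sg (- 2) (f \<theta>)"
    using assms(8)[OF \<theta>(1)] by auto
  have "actN (e \<theta>) (actN (e \<theta>) a) = 0" "actN (f \<theta>) (actN (f \<theta>) a) = 0" for a
    using act_eigenvector_square[OF ef(1)] act_eigenvector_square[OF ef(2)] by simp_all
  then show ?thesis
    using P \<Lambda> rank_one_type[OF \<theta>(2)] by (simp add: BA_zero_def zero_prod_def)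
qed

end
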